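(* For every $n\ge 1$, every $\pi\in\mathcal{S}_n$, and every $\mathcal{L}=(L_1,\dots,L_n)$ with $L_i\subseteq[n]$, \[\mathrm{SP}(n,\mathcal{L},\pi)=\prod_{i=1}^n\left(\sum_{\ell\in L_i}\binom{n-\mathrm{inv}_i(\pi)-1}{\ell-1}\right).\]
   Context: Let $[n]=\{1,\dots,n\}$, $\mathcal{S}_n$ the permutations of $[n]$ in one-line notation, and $\pi_i^{-1}$ the position $j$ with $\pi_j=i$. A tuple $(C_1,\dots,C_n)$ of non-empty subsets of $[n]$ is a subset parking function with outcome $\pi$ if for every $1\le i\le n$, $\pi_i^{-1}$ is the smallest element of $C_i\setminus\{\pi_{i'}^{-1}:i'<i\}$; it is an $\mathcal{L}$-parking function if also $|C_i|\in L_i$ for all $i$. $\mathrm{SP}(n,\mathcal{L},\pi)$ is the number of $\mathcal{L}$-parking functions with outcome $\pi$. For a value $1\le i\le n$, $\mathrm{inv}_i(\pi)$ is the number of positions $q<\pi_i^{-1}$ with $\pi_q>i$. Binomial conventions: $\binom{0}{0}=1$, $\binom{a}{b}=0$ for $b>a\ge 0$. *)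

theory Defs
  imports Main "HOL-Library.FuncSet" "HOL-Combinatorics.Permutations"
begin

text \<open>
  Permutations of $[n]$ are functions \<open>\<pi>\<close> with \<open>\<pi> permutes {1..n}\<close>, one-line notation being
  \<open>\<pi> 1, \<dots>, \<pi> n\<close>; the position of the value \<open>i\<close> is \<open>inv \<pi> i\<close>.
  A tuple $(C_1,\dots,C_n)$ is an extensional function on \<open>{1..n}\<close>, so that distinct functions
  are distinct tuples and tuples can be counted with \<open>card\<close>.
\<close>

definition is_smallest :: "'a::linorder \<Rightarrow> 'a set \<Rightarrow> bool" where
  "is_smallest x S \<longleftrightarrow> x \<in> S \<and> (\<forall>y\<in>S. x \<le> y)"

definition subset_parking_function :: "nat \<Rightarrow> (nat \<Rightarrow> nat) \<Rightarrow> (nat \<Rightarrow> nat set) \<Rightarrow> bool" where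
  "subset_parking_function n \<pi> C \<longleftrightarrow>
     C \<in> {1..n} \<rightarrow>\<^sub>E {A. A \<subseteq> {1..n} \<and> A \<noteq> {}} \<and>
     (\<forall>i\<in>{1..n}. is_smallest (inv \<pi> i) (C i - {inv \<pi> i' | i'. 1 \<le> i' \<and> i' < i}))"

definition L_parking_function ::
    "nat \<Rightarrow> (nat \<Rightarrow> nat set) \<Rightarrow> (nat \<Rightarrow> nat) \<Rightarrow> (nat \<Rightarrow> nat set) \<Rightarrow> bool" where
  "L_parking_function n L \<pi> C \<longleftrightarrow>
     subset_parking_function n \<pi> C \<and> (\<forall>i\<in>{1..n}. card (C i) \<in> L i)"

definition SP :: "nat \<Rightarrow> (nat \<Rightarrow> nat set) \<Rightarrow> (nat \<Rightarrow> nat) \<Rightarrow> nat" where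
  "SP n L \<pi> = card {C. L_parking_function n L \<pi> C}"

definition inv_count :: "(nat \<Rightarrow> nat) \<Rightarrow> nat \<Rightarrow> nat" where
  "inv_count \<pi> i = card {q. 1 \<le> q \<and> q < inv \<pi> i \<and> \<pi> q > i}"

end

theory Submission
  imports Defs
begin

text \<open>
  Once \<open>\<pi>\<close> is fixed, the conditions on \<open>C 1, \<dots>, C n\<close> are independent: \<open>C i\<close> must contain the
  position of the value \<open>i\<close> and avoid every smaller position carrying a value greater than \<open>i\<close>.
  The other \<open>n - inv_count \<pi> i - 1\<close> positions are free.
\<close>

text \<open>Deleting \<open>x\<close> leaves an arbitrary subset of \<open>M - {x}\<close> of size
  \<open>l - 1\<close>. At \<open>l = 0\<close> truncated subtraction would give the value 1,
  although no such \<open>A\<close> exists; hence \<open>l \<ge> 1\<close>.\<close>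

lemma card_subsets_containing:
  assumes "finite M" "x \<in> M" "l \<ge> 1"
  shows "card {A. A \<subseteq> M \<and> x \<in> A \<and> card A = l} = (card M - 1) choose (l - 1)"
proof -
  have fin: "finite B" if "B \<subseteq> M" for B
    using that assms(1) by (rule finite_subset)
  have "bij_betw (insert x) {B. B \<subseteq> M - {x} \<and> card B = l - 1} {A. A \<subseteq> M \<and> x \<in> A \<and> card A = l}"
  proof (rule bij_betw_byWitness[where f' = "\<lambda>A. A - {x}"])
    show "insert x ` {B. B \<subseteq> M - {x} \<and> card B = l - 1} \<subseteq> {A. A \<subseteq> M \<and> x \<in> A \<and> card A = l}"
    proof (rule image_subsetI)
      fix B assume "B \<in> {B. B \<subseteq> M - {x} \<and> card B = l - 1}"
      then have B: "B \<subseteq> M" "x \<notin> B" "card B = l - 1"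
        by auto
      then show "insert x B \<in> {A. A \<subseteq> M \<and> x \<in> A \<and> card A = l}"
        using assms(2,3) fin[OF B(1)] by simp
    qed
  qed (use fin in auto)
  then have "card {A. A \<subseteq> M \<and> x \<in> A \<and> card A = l} = card {B. B \<subseteq> M - {x} \<and> card B = l - 1}"
    by (simp add: bij_betw_same_card)
  also have "\<dots> = (card M - 1) choose (l - 1)"
    using assms by (simp add: n_subsets)
  finally show ?thesis .
qed

lemma card_subsets_containing_sizes:
  assumes "finite M" "x \<in> M" "finite L" "0 \<notin> L"
  shows "card {A. A \<subseteq> M \<and> x \<in> A \<and> card A \<in> L} = (\<Sum>l\<in>L. (card M - 1) choose (l - 1))"
proof -
  have "{A. A \<subseteq> M \<and> x \<in> A \<and> card A \<in> L} = (\<Union>l\<in>L. {A. A \<subseteq> M \<and> x \<in> A \<and> card A = l})"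
    by auto
  also have "card \<dots> = (\<Sum>l\<in>L. card {A. A \<subseteq> M \<and> x \<in> A \<and> card A = l})"
  proof (rule card_UN_disjoint)
    show "\<forall>l\<in>L. finite {A. A \<subseteq> M \<and> x \<in> A \<and> card A = l}"
      using assms(1) by simp
  qed (use assms(3) in auto)
  also have "\<dots> = (\<Sum>l\<in>L. (card M - 1) choose (l - 1))"
    using assms by (intro sum.cong refl card_subsets_containing) (auto intro: Suc_leI gr0I)
  finally show ?thesis .
qed

text \<open>The forbidden positions for \<open>C i\<close>: each lies left of
  \<open>inv \<pi> i\<close> and is still unoccupied when \<open>i\<close> parks, so it would be
  chosen first.\<close>

definition inv_positions :: "(nat \<Rightarrow> nat) \<Rightarrow> nat \<Rightarrow> nat set" where
  "inv_positions \<pi> i = {q. 1 \<le> q \<and> q < inv \<pi> i \<and> \<pi> q > i}"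

lemma card_inv_positions: "card (inv_positions \<pi> i) = inv_count \<pi> i"
  by (simp add: inv_positions_def inv_count_def)

text \<open>The occupied positions are those carrying values below \<open>i\<close>, so they never
  obstruct minimality; only the larger values further left do. The right-hand side constrains a
  single set \<open>A\<close>, which decouples the coordinates.\<close>

lemma is_smallest_free_position_iff:
  assumes "\<pi> permutes {1..n}" "i \<in> {1..n}" "A \<subseteq> {1..n}"
  shows "is_smallest (inv \<pi> i) (A - {inv \<pi> i' | i'. 1 \<le> i' \<and> i' < i}) \<longleftrightarrow>
    A \<subseteq> {1..n} - inv_positions \<pi> i \<and> inv \<pi> i \<in> A"
proof -
  have occ: "q \<in> {inv \<pi> i' | i'. 1 \<le> i' \<and> i' < i} \<longleftrightarrow> \<pi> q < i" if "q \<in> {1..n}" for q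
  proof -
    have "q = inv \<pi> i' \<longleftrightarrow> \<pi> q = i'" for i'
      using permutes_inv_eq[OF assms(1), of i' q] by auto
    \<comment> \<open>The only candidate for \<open>i'\<close> is \<open>\<pi> q\<close>, and it has
      to meet the bound \<open>1 \<le> i'\<close>.\<close>
    moreover have "1 \<le> \<pi> q"
      using permutes_in_image[OF assms(1), of q] that by simp
    ultimately show ?thesis by simp
  qed
  have val: "\<pi> (inv \<pi> i) = i"
    using permutes_inverses[OF assms(1)] by simp
  have pos: "inv \<pi> i \<in> {1..n}"
    using permutes_in_image[OF permutes_inv[OF assms(1)]] assms(2) by simp
  have "A - {inv \<pi> i' | i'. 1 \<le> i' \<and> i' < i} = {q \<in> A. i \<le> \<pi> q}"
  proof (rule set_eqI)
    fix q
    show "q \<in> A - {inv \<pi> i' | i'. 1 \<le> i' \<and> i' < i} \<longleftrightarrow> q \<in> {q \<in> A. i \<le> \<pi> q}"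
    proof (cases "q \<in> A")
      case True
      then have "q \<in> {1..n}" using assms(3) by (rule rev_subsetD)
      then show ?thesis
        unfolding Diff_iff occ[OF \<open>q \<in> {1..n}\<close>] by (simp add: True not_less)
    qed simp
  qed
  moreover have "is_smallest (inv \<pi> i) {q \<in> A. i \<le> \<pi> q} \<longleftrightarrow>
    inv \<pi> i \<in> A \<and> (\<forall>q\<in>A. q < inv \<pi> i \<longrightarrow> \<not> i < \<pi> q)"
  proof -
    \<comment> \<open>Contraposition, with \<open>\<le>\<close> sharpened to \<open><\<close>: the
      value \<open>i\<close> occurs only at \<open>inv \<pi> i\<close>, so
      \<open>\<pi> q = i\<close> is impossible for \<open>q < inv \<pi> i\<close>.\<close>
    have "(i \<le> \<pi> q \<longrightarrow> inv \<pi> i \<le> q) \<longleftrightarrow> (q < inv \<pi> i \<longrightarrow> \<not> i < \<pi> q)" for q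
    proof -
      have "q = inv \<pi> i \<longleftrightarrow> \<pi> q = i"
        using permutes_inv_eq[OF assms(1), of i q] by auto
      then show ?thesis by linarith
    qed
    then show ?thesis
      by (simp add: is_smallest_def val Ball_def imp_conjL)
  qed
  moreover have "\<dots> \<longleftrightarrow> A \<subseteq> {1..n} - inv_positions \<pi> i \<and> inv \<pi> i \<in> A"
    using assms(3) by (auto simp: inv_positions_def)
  ultimately show ?thesis by simp
qed

text \<open>Writing the set as a dependent product lets \<open>card_PiE\<close> turn the count into
  a product over \<open>i\<close>. Non-emptiness of \<open>C i\<close> is absorbed by
  \<open>inv \<pi> i \<in> A\<close>.\<close>

lemma L_parking_functions_eq_PiE:
  assumes "\<pi> permutes {1..n}"
  shows "{C. L_parking_function n L \<pi> C} =
    (\<Pi>\<^sub>E i\<in>{1..n}. {A. A \<subseteq> {1..n} - inv_positions \<pi> i \<and> inv \<pi> i \<in> A \<and> card A \<in> L i})"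
    (is "_ = Pi\<^sub>E _ ?S")
proof -
  have "C i \<in> {A. A \<subseteq> {1..n} \<and> A \<noteq> {}} \<and>
      is_smallest (inv \<pi> i) (C i - {inv \<pi> i' | i'. 1 \<le> i' \<and> i' < i}) \<and> card (C i) \<in> L i
    \<longleftrightarrow> C i \<in> ?S i" if "i \<in> {1..n}" for C i
    using is_smallest_free_position_iff[OF assms that, of "C i"] by blast
  then show ?thesis
    unfolding L_parking_function_def subset_parking_function_def PiE_iff set_eq_iff mem_Collect_eq
    by meson
qed

theorem theorem2p4:
  fixes n :: nat and \<pi> :: "nat \<Rightarrow> nat" and L :: "nat \<Rightarrow> nat set"
  assumes "n \<ge> 1"
    and "\<pi> permutes {1..n}"
    and "\<And>i. i \<in> {1..n} \<Longrightarrow> L i \<subseteq> {1..n}"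
  shows "SP n L \<pi> = (\<Prod>i=1..n. \<Sum>l\<in>L i. (n - inv_count \<pi> i - 1) choose (l - 1))"
proof -
  have "card {A. A \<subseteq> {1..n} - inv_positions \<pi> i \<and> inv \<pi> i \<in> A \<and> card A \<in> L i} =
    (\<Sum>l\<in>L i. (n - inv_count \<pi> i - 1) choose (l - 1))" if i: "i \<in> {1..n}" for i
  proof -
    have pos: "inv \<pi> i \<in> {1..n}"
      using permutes_in_image[OF permutes_inv[OF assms(2)]] i by simp
    have sub: "inv_positions \<pi> i \<subseteq> {1..n}"
      using pos by (auto simp: inv_positions_def)
    then have "card ({1..n} - inv_positions \<pi> i) = n - inv_count \<pi> i"
      by (simp add: card_Diff_subset finite_subset card_inv_positions)
    moreover have "inv \<pi> i \<in> {1..n} - inv_positions \<pi> i"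
      using pos by (simp add: inv_positions_def)
    \<comment> \<open>Both come from \<open>L i \<subseteq> {1..n}\<close>; excluding 0 keeps
      \<open>l - 1\<close> a true subtraction.\<close>
    moreover have "finite (L i)" "0 \<notin> L i"
      using assms(3)[OF i] by (auto intro: finite_subset)
    ultimately show ?thesis
      by (simp add: card_subsets_containing_sizes)
  qed
  then show ?thesis
    by (simp add: SP_def L_parking_functions_eq_PiE[OF assms(2)] card_PiE)
qed

end
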